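(* Suppose that $F=f+g$ is bounded below; $\nabla f$ is $L$-Lipschitz continuous on $\mathbb{R}^d$ (with $L>0$); $g$ is closed and separable, i.e. $g(\mathbf{x})=\sum_{i=1}^p g_i(x_i)$; and that there is $s\in\mathbb{N}$ (possibly $0$) such that (bounded delay) for all $i,j,t$, $0\le t-\tau_j^i(t)\le s$ and $\tau_i^i(t)=t$, and (frequent update) for all $i,t$, $T_i\cap\{t,t+1,\ldots,t+s\}\neq\emptyset$. If the step size satisfies $\eta\in\left(0,\frac{1}{L(1+2\sqrt{p}\,s)}\right)$, then the sequences $\{\mathbf{x}(t)\}$ and $\{\mathbf{x}^i(t)\}$, $i=1,\ldots,p$, generated by m-PAPG share the same set of limit points, and this set is a subset of $\operatorname{crit}F$. (Neither $f$ nor $g$ is assumed convex.)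
   Context: Setting. $\mathbb{R}^d=\mathbb{R}^{d_1}\times\cdots\times\mathbb{R}^{d_p}$, $\mathbf{x}=(x_1,\ldots,x_p)$ with $x_i\in\mathbb{R}^{d_i}$; $\|\cdot\|$ is the Euclidean norm. $f:\mathbb{R}^d\to\mathbb{R}$ is differentiable, with $i$-th block of the gradient denoted $\nabla_i f:\mathbb{R}^d\to\mathbb{R}^{d_i}$; $g:\mathbb{R}^d\to(-\infty,+\infty]$ and $g_i:\mathbb{R}^{d_i}\to(-\infty,+\infty]$ are proper (not identically $+\infty$) and closed (all sublevel sets closed). $F=f+g$. Proximal map: $\mathrm{prox}_h^{\eta}(x)=\operatorname{argmin}_z\, h(z)+\frac{1}{2\eta}\|z-x\|^2$; if this set has more than one element, $\mathrm{prox}_h^\eta(x)$ denotes an arbitrary element of it. m-PAPG algorithm. Time is $t=0,1,2,\ldots$. For each machine $i\in\{1,\ldots,p\}$ a set $T_i\subseteq\{0,1,2,\ldots\}$ of active clocks is given, and for all $i,j,t$ an integer $\tau_j^i(t)$ with $0\le\tau_j^i(t)\le t$. From an initial point $\mathbf{x}(0)\in\mathbb{R}^d$ and a step size $\eta>0$, the global sequence $\mathbf{x}(t)=(x_1(t),\ldots,x_p(t))$ and the local sequences $\mathbf{x}^i(t)=(x_1(\tau_1^i(t)),\ldots,x_p(\tau_p^i(t)))$ are generated by: for each $i$, $x_i(t+1)=x_i(t)$ if $t\notin T_i$, and $x_i(t+1)=\mathrm{prox}_{g_i}^{\eta}\big(x_i(t)-\eta\nabla_i f(\mathbf{x}^i(t))\big)$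 if $t\in T_i$. Subdifferential and critical points: for proper closed $h$ and $\mathbf{x}\in\operatorname{dom}h$, the Fréchet subdifferential $\hat\partial h(\mathbf{x})$ is the set of $\mathbf{u}$ with $\liminf_{\mathbf{z}\to\mathbf{x},\mathbf{z}\ne\mathbf{x}}\frac{h(\mathbf{z})-h(\mathbf{x})-\mathbf{u}^\top(\mathbf{z}-\mathbf{x})}{\|\mathbf{z}-\mathbf{x}\|}\ge0$; the limiting subdifferential is $\partial h(\mathbf{x})=\{\mathbf{u}:\exists\,\mathbf{x}^k\to\mathbf{x},\ h(\mathbf{x}^k)\to h(\mathbf{x}),\ \mathbf{u}^k\in\hat\partial h(\mathbf{x}^k),\ \mathbf{u}^k\to\mathbf{u}\}$; and $\operatorname{crit}h=\{\mathbf{x}:\mathbf{0}\in\partial h(\mathbf{x})\}$. *)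

theory Defs
  imports "HOL-Analysis.Analysis"
begin

section \<open>Extended-real-valued functions\<close>

text \<open>
  Functions into \<open>(-\<infinity>, +\<infinity>]\<close> are \<open>ereal\<close>-valued functions avoiding \<open>-\<infinity>\<close>.  The carrier \<open>S\<close>
  is a closed set outside of which the values are irrelevant, so that sublevel sets are closed
  in \<open>S\<close> iff they are closed in the ambient space.
\<close>

definition proper_on :: "'a set \<Rightarrow> ('a \<Rightarrow> ereal) \<Rightarrow> bool" where
  "proper_on S h \<longleftrightarrow> (\<forall>x\<in>S. h x \<noteq> -\<infinity>) \<and> (\<exists>x\<in>S. h x \<noteq> \<infinity>)"

definition closed_fun_on :: "'a::topological_space set \<Rightarrow> ('a \<Rightarrow> ereal) \<Rightarrow> bool" where
  "closed_fun_on S h \<longleftrightarrow> (\<forall>c::real. closed {x\<in>S. h x \<le> ereal c})"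

definition prox_on ::
  "'a::real_inner set \<Rightarrow> ('a \<Rightarrow> ereal) \<Rightarrow> real \<Rightarrow> 'a \<Rightarrow> 'a set" where
  "prox_on S h \<eta> x =
     {z. is_arg_min (\<lambda>z. h z + ereal (1 / (2 * \<eta>) * (norm (z - x))\<^sup>2)) (\<lambda>z. z \<in> S) z}"

definition frechet_subdiff :: "('a::real_inner \<Rightarrow> ereal) \<Rightarrow> 'a \<Rightarrow> 'a set" where
  "frechet_subdiff h x =
     {u. h x < \<infinity> \<and>
         Liminf (at x) (\<lambda>z. (h z - h x - ereal (u \<bullet> (z - x))) / ereal (norm (z - x))) \<ge> 0}"

definition limiting_subdiff :: "('a::real_inner \<Rightarrow> ereal) \<Rightarrow> 'a \<Rightarrow> 'a set" where
  "limiting_subdiff h x =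
     {u. h x < \<infinity> \<and>
         (\<exists>xs us. xs \<longlonglongrightarrow> x \<and> (\<lambda>k. h (xs k)) \<longlonglongrightarrow> h x \<and>
                  (\<forall>k::nat. us k \<in> frechet_subdiff h (xs k)) \<and> us \<longlonglongrightarrow> u)}"

definition crit :: "('a::real_inner \<Rightarrow> ereal) \<Rightarrow> 'a set" where
  "crit h = {x. 0 \<in> limiting_subdiff h x}"

definition limit_points :: "(nat \<Rightarrow> 'a::topological_space) \<Rightarrow> 'a set" where
  "limit_points X = {y. \<exists>r::nat \<Rightarrow> nat. strict_mono r \<and> (X \<circ> r) \<longlonglongrightarrow> y}"

section \<open>Block decomposition\<close>

text \<open>
  The decomposition of \<open>\<real>\<^sup>d\<close> as the product of the \<open>\<real>\<^sup>d\<^sub>i\<close> is given by a map \<open>blk\<close> assigning to each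
  coordinate \<open>k :: 'n\<close> the block (machine) \<open>blk k :: 'p\<close> it belongs to, so \<open>d = CARD('n)\<close>,
  \<open>p = CARD('p)\<close> and \<open>d\<^sub>i = card {k. blk k = i}\<close>.  The factor \<open>\<real>\<^sup>d\<^sub>i\<close> is represented by its
  isometric copy in \<open>\<real>\<^sup>d\<close>, the vectors vanishing outside of block \<open>i\<close>; a function on \<open>\<real>\<^sup>d\<^sub>i\<close> is a
  function of which only the values on that copy are used.
\<close>

definition block_space :: "('n::finite \<Rightarrow> 'p) \<Rightarrow> 'p \<Rightarrow> (real ^ 'n) set" where
  "block_space blk i = {v. \<forall>k. blk k \<noteq> i \<longrightarrow> v $ k = 0}"

definition block :: "('n::finite \<Rightarrow> 'p) \<Rightarrow> 'p \<Rightarrow> real ^ 'n \<Rightarrow> real ^ 'n" where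
  "block blk i x = (\<chi> k. if blk k = i then x $ k else 0)"

section \<open>The algorithm\<close>

text \<open>\<open>\<tau> i j t\<close> is the time stamp of the copy of block \<open>j\<close> available to machine \<open>i\<close> at time \<open>t\<close>.\<close>

definition local_seq ::
  "('n::finite \<Rightarrow> 'p) \<Rightarrow> ('p \<Rightarrow> 'p \<Rightarrow> nat \<Rightarrow> nat) \<Rightarrow> (nat \<Rightarrow> real ^ 'n) \<Rightarrow> 'p \<Rightarrow> nat \<Rightarrow> real ^ 'n" where
  "local_seq blk \<tau> x i t = (\<chi> k. x (\<tau> i (blk k) t) $ k)"

text \<open>
  The initial point \<open>x 0\<close> is unconstrained, and at each step any element of the proximal set
  may be selected.
\<close>

definition mpapg ::
  "('n::finite \<Rightarrow> 'p) \<Rightarrow> (real ^ 'n \<Rightarrow> real ^ 'n) \<Rightarrow> ('p \<Rightarrow> real ^ 'n \<Rightarrow> ereal) \<Rightarrow> real \<Rightarrow>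
   ('p \<Rightarrow> nat set) \<Rightarrow> ('p \<Rightarrow> 'p \<Rightarrow> nat \<Rightarrow> nat) \<Rightarrow> (nat \<Rightarrow> real ^ 'n) \<Rightarrow> bool" where
  "mpapg blk gradf gs \<eta> T \<tau> x \<longleftrightarrow>
     (\<forall>i t. (t \<notin> T i \<longrightarrow> block blk i (x (Suc t)) = block blk i (x t)) \<and>
            (t \<in> T i \<longrightarrow> block blk i (x (Suc t)) \<in>
               prox_on (block_space blk i) (gs i) \<eta>
                 (block blk i (x t) - \<eta> *\<^sub>R block blk i (gradf (local_seq blk \<tau> x i t)))))"

end

theory Submission
  imports Defs
begin

text \<open>
  The proximal inequality of each active block and the descent lemma for \<open>f\<close> bound
  \<open>F (x (t + 1)) - F (x t)\<close> by \<open>- (1 / (2 \<eta>) - L / 2) \<parallel>\<Delta> t\<parallel>\<^sup>2\<close>, where \<open>\<Delta> t = x (t + 1) - x t\<close>, plus an error from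
  the stale gradients of at most \<open>L \<surd>p \<parallel>\<Delta> t\<parallel> (\<parallel>\<Delta> (t - 1)\<parallel> + \<dots> + \<parallel>\<Delta> (t - s)\<parallel>)\<close>.  By AM-GM, the errors sum to
  at most \<open>L \<surd>p s \<Sum>\<parallel>\<Delta> t\<parallel>\<^sup>2\<close> up to a constant, so the step size condition makes \<open>\<parallel>\<Delta> t\<parallel>\<^sup>2\<close> summable; the
  summation starts after time \<open>s\<close>, when every block has been updated and \<open>F (x t)\<close> is finite.
  Hence \<open>\<Delta> t\<close> tends to \<open>0\<close>, and the global and local sequences have the same limit points.

  At a limit point \<open>y\<close> of \<open>x (r k)\<close>, let \<open>z k\<close> collect, for every block, its value after an update in
  the window \<open>{r k..r k + s}\<close>.  Optimality of these updates gives Frechet subgradients of \<open>F\<close> at \<open>z k\<close>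
  that tend to \<open>0\<close>.  Comparing the proximal values with \<open>y\<close> and using closedness of each \<open>g\<^sub>i\<close> gives
  \<open>F (z k) \<longlonglongrightarrow> F y\<close>, although \<open>F\<close> is not continuous.
\<close>

section \<open>Orthogonal projections onto the blocks\<close>

lemma block_nth [simp]: "block blk i x $ k = (if blk k = i then x $ k else 0)"
  by (simp add: block_def)

lemma block_in_block_space [simp]: "block blk i x \<in> block_space blk i"
  by (simp add: block_space_def)

lemma linear_block: "linear (block blk i)"
  by (rule linearI) (auto simp: vec_eq_iff)

lemmas block_add = linear_add[OF linear_block]
  and block_diff = linear_diff[OF linear_block]
  and block_scaleR = linear_scale[OF linear_block]
  and block_sum = linear_sum[OF linear_block]

lemma tendsto_block: "(X \<longlongrightarrow> y) A \<Longrightarrow> ((\<lambda>k. block blk i (X k)) \<longlongrightarrow> block blk i y) A"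
  by (rule bounded_linear.tendsto[OF linear_conv_bounded_linear[THEN iffD1, OF linear_block]])

lemma block_block: "block blk i (block blk j x) = (if i = j then block blk i x else 0)"
  by (auto simp: vec_eq_iff)

lemma sum_block: "(\<Sum>i\<in>UNIV. block blk i x) = x"
  for blk :: "'n::finite \<Rightarrow> 'p::finite"
  by (simp add: vec_eq_iff)

lemma block_sum_block: "block blk i (\<Sum>j\<in>UNIV. block blk j (X j)) = block blk i (X i)"
  for blk :: "'n::finite \<Rightarrow> 'p::finite"
  by (simp add: block_sum block_block)

text \<open>An orthogonal projection is self-adjoint and idempotent.\<close>

lemma inner_block_block: "block blk i x \<bullet> block blk i y = x \<bullet> block blk i y"
  unfolding inner_vec_def by (rule sum.cong) auto

lemma sum_inner_block:
  fixes blk :: "'n::finite \<Rightarrow> 'p::finite"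
  shows "(\<Sum>i\<in>UNIV. block blk i x \<bullet> block blk i y) = x \<bullet> y"
  by (simp add: inner_block_block flip: inner_sum_right) (simp add: sum_block)

lemma sum_norm_block_sq:
  fixes blk :: "'n::finite \<Rightarrow> 'p::finite"
  shows "(\<Sum>i\<in>UNIV. (norm (block blk i x))\<^sup>2) = (norm x)\<^sup>2"
  by (simp add: power2_norm_eq_inner sum_inner_block)

text \<open>Cauchy-Schwarz against the all-ones vector. The factor
  \<open>sqrt (real CARD('p))\<close> of the step size bound comes from here.\<close>

lemma sum_norm_block_le:
  fixes blk :: "'n::finite \<Rightarrow> 'p::finite"
  shows "(\<Sum>i\<in>UNIV. norm (block blk i x)) \<le> sqrt (real CARD('p)) * norm x"
proof -
  have "(\<Sum>i\<in>UNIV. \<bar>1\<bar> * \<bar>norm (block blk i x)\<bar>)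
      \<le> L2_set (\<lambda>_. 1) (UNIV :: 'p set) * L2_set (\<lambda>i. norm (block blk i x)) UNIV"
    by (rule L2_set_mult_ineq)
  then show ?thesis
    by (simp add: L2_set_def sum_norm_block_sq)
qed

section \<open>Quadratic minorants of extended-real functions\<close>

text \<open>Expanding \<open>(norm (w - c))\<^sup>2\<close> about \<open>z\<close> turns minimality
  into a quadratic minorant of \<open>h\<close> that is attained at \<open>z\<close>. It takes the
  place of convexity: descent, limits of function values and subgradients all follow from it. A
  finite competitor \<open>w0\<close> makes \<open>h z\<close> finite.\<close>

lemma prox_onD:
  assumes prox: "z \<in> prox_on S h \<eta> c" and proper: "proper_on S h" and "\<eta> > 0"
  obtains r where "z \<in> S" "h z = ereal r"
    "\<And>w. w \<in> S \<Longrightarrow>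
       ereal (r - ((1 / \<eta>) *\<^sub>R (z - c)) \<bullet> (w - z) - 1 / (2 * \<eta>) * (norm (w - z))\<^sup>2) \<le> h w"
proof -
  have zS: "z \<in> S" and le: "\<And>w. w \<in> S \<Longrightarrow> h z + ereal (1 / (2 * \<eta>) * (norm (z - c))\<^sup>2)
      \<le> h w + ereal (1 / (2 * \<eta>) * (norm (w - c))\<^sup>2)"
    using prox by (auto simp: prox_on_def is_arg_min_linorder)
  obtain w0 where w0: "w0 \<in> S" "h w0 \<noteq> \<infinity>" using proper by (auto simp: proper_on_def)
  have fin: "h z \<noteq> \<infinity>" "h z \<noteq> -\<infinity>"
    using le[OF w0(1)] w0 proper zS by (auto simp: proper_on_def)
  then obtain r where r: "h z = ereal r" by (cases "h z") auto
  show thesis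
  proof (rule that[OF zS r])
    fix w assume w: "w \<in> S"
    have exp: "(norm (w - c))\<^sup>2 = (norm (w - z))\<^sup>2 + 2 * ((z - c) \<bullet> (w - z)) + (norm (z - c))\<^sup>2"
      by (simp add: power2_norm_eq_inner algebra_simps inner_commute)
    show "ereal (r - ((1 / \<eta>) *\<^sub>R (z - c)) \<bullet> (w - z) - 1 / (2 * \<eta>) * (norm (w - z))\<^sup>2) \<le> h w"
    proof (cases "h w")
      case (real q)
      have "r + 1 / (2 * \<eta>) * (norm (z - c))\<^sup>2 \<le> q + 1 / (2 * \<eta>) * (norm (w - c))\<^sup>2"
        using le[OF w] by (simp add: r real)
      then show ?thesis
        unfolding exp real using \<open>\<eta> > 0\<close> by (simp add: divide_simps)
    qed (use w proper in \<open>auto simp: proper_on_def\<close>)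
  qed
qed

text \<open>\<^const>\<open>closed_fun_on\<close> yields the lower bound on the limit of \<open>q\<close>, the quadratic minorant at
  \<open>w = y\<close> the upper one.\<close>

lemma quadratic_minorants_imp_attentive:
  fixes zs a :: "nat \<Rightarrow> 'a::real_inner"
  assumes closed: "closed_fun_on S h" and proper: "proper_on S h"
    and zs: "zs \<longlonglongrightarrow> y" "\<And>k. zs k \<in> S" and y: "y \<in> S"
    and q: "\<And>k. h (zs k) = ereal (q k)"
    and minorant: "\<And>k w. w \<in> S \<Longrightarrow>
       ereal (q k - a k \<bullet> (w - zs k) - C * (norm (w - zs k))\<^sup>2) \<le> h w"
    and a: "a \<longlonglongrightarrow> a0"
  obtains r where "h y = ereal r" "q \<longlonglongrightarrow> r"
proof -
  define e where "e w k = a k \<bullet> (w - zs k) + C * (norm (w - zs k))\<^sup>2" for w k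
  have e_lim: "e w \<longlonglongrightarrow> a0 \<bullet> (w - y) + C * (norm (w - y))\<^sup>2" for w
    unfolding e_def by (intro tendsto_intros zs a)
  have upper: "q k \<le> b + e w k" if "w \<in> S" "h w = ereal b" for w b k
    using minorant[OF that(1), of k] that(2) by (simp add: e_def)
  have lower: "\<forall>\<^sub>F k in sequentially. c < q k" if "ereal c < h y" for c
  proof -
    have "open (- {x\<in>S. h x \<le> ereal c})"
      using closed by (auto simp: closed_fun_on_def)
    then have "\<forall>\<^sub>F k in sequentially. zs k \<in> - {x\<in>S. h x \<le> ereal c}"
      using that by (intro topological_tendstoD[OF zs(1)]) auto
    then show ?thesis by eventually_elim (use zs(2) q in auto)
  qed
  obtain w0 b where w0: "w0 \<in> S" "h w0 = ereal b"
  proof -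
    obtain w0 where "w0 \<in> S" "h w0 \<noteq> \<infinity>" "h w0 \<noteq> -\<infinity>" using proper by (auto simp: proper_on_def)
    then show thesis by (intro that[of w0 "real_of_ereal (h w0)"]) (auto simp: ereal_real)
  qed
  \<comment> \<open>If \<open>h y\<close> were infinite, closedness would push \<open>q\<close>
    above every real, whereas the minorants at the fixed finite point \<open>w0\<close> keep
    \<open>q\<close> bounded above.\<close>
  have "h y \<noteq> \<infinity>"
  proof
    assume inf: "h y = \<infinity>"
    \<comment> \<open>\<open>B\<close> exceeds the limit of the upper bound from \<open>w0\<close>
      by \<open>1\<close>.\<close>
    define B where "B = b + (a0 \<bullet> (w0 - y) + C * (norm (w0 - y))\<^sup>2) + 1"
    have "(\<lambda>k. b + e w0 k) \<longlonglongrightarrow> B - 1"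
      unfolding B_def by (rule tendsto_eq_intros e_lim refl | simp)+
    then have "\<forall>\<^sub>F k in sequentially. b + e w0 k < B" by (rule order_tendstoD) simp
    moreover have "\<forall>\<^sub>F k in sequentially. B < q k" by (rule lower) (simp add: inf)
    ultimately have "\<forall>\<^sub>F k in sequentially. False"
      by eventually_elim (use upper[OF w0] in \<open>smt (verit)\<close>)
    then show False by simp
  qed
  moreover have "h y \<noteq> -\<infinity>" using proper y by (auto simp: proper_on_def)
  ultimately obtain r where r: "h y = ereal r" by (cases "h y") auto
  have "q \<longlonglongrightarrow> r"
  proof (rule order_tendstoI)
    show "\<forall>\<^sub>F k in sequentially. c < q k" if "c < r" for c
      using that by (intro lower) (simp add: r)
  next
    fix c assume "r < c"
    moreover have "(\<lambda>k. r + e y k) \<longlonglongrightarrow> r"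
      by (rule tendsto_eq_intros e_lim refl | simp)+
    ultimately have "\<forall>\<^sub>F k in sequentially. r + e y k < c" by (intro order_tendstoD(2))
    then show "\<forall>\<^sub>F k in sequentially. q k < c"
      by eventually_elim (use upper[OF y r] in \<open>smt (verit)\<close>)
  qed
  with r show thesis by (rule that)
qed

text \<open>Division by \<open>norm (w - z)\<close> leaves an error of only
  \<open>C * norm (w - z)\<close>, which vanishes as \<open>w\<close> approaches
  \<open>z\<close>.\<close>

lemma frechet_subdiff_quadraticI:
  fixes z :: "'a::euclidean_space"
  assumes r: "h z = ereal r"
    and minorant: "\<And>w. ereal (r + u \<bullet> (w - z) - C * (norm (w - z))\<^sup>2) \<le> h w"
  shows "u \<in> frechet_subdiff h z"
proof -
  let ?Q = "\<lambda>w. (h w - h z - ereal (u \<bullet> (w - z))) / ereal (norm (w - z))"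
  have "ereal (- C * norm (w - z)) \<le> ?Q w" if "w \<noteq> z" for w
  proof (cases "h w")
    case (real q)
    have "- C * norm (w - z) * norm (w - z) \<le> q - r - u \<bullet> (w - z)"
      using minorant[of w] by (simp add: real power2_eq_square algebra_simps)
    then have "- C * norm (w - z) \<le> (q - r - u \<bullet> (w - z)) / norm (w - z)"
      using that by (subst pos_le_divide_eq) auto
    then show ?thesis by (simp add: real r that)
  next
    case PInf
    then show ?thesis by (simp add: r that)
  next
    case MInf
    then show ?thesis using minorant[of w] by simp
  qed
  then have "Liminf (at z) (\<lambda>w. ereal (- C * norm (w - z))) \<le> Liminf (at z) ?Q"
    by (intro Liminf_mono) (simp add: eventually_at_filter)
  moreover have "((\<lambda>w. - C * norm (w - z)) \<longlongrightarrow> - C * norm (z - z)) (at z)"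
    by (intro tendsto_intros)
  then have "((\<lambda>w. ereal (- C * norm (w - z))) \<longlongrightarrow> 0) (at z)"
    by (simp add: zero_ereal_def)
  then have "Liminf (at z) (\<lambda>w. ereal (- C * norm (w - z))) = 0"
    by (intro lim_imp_Liminf) auto
  ultimately show ?thesis by (simp add: frechet_subdiff_def r)
qed

section \<open>Quadratic bounds from a Lipschitz gradient\<close>

lemma descent_lemma:
  fixes f :: "'a::real_inner \<Rightarrow> real"
  assumes grad: "\<And>z. GDERIV f z :> gradf z" and lip: "L-lipschitz_on UNIV gradf"
  shows "f w \<le> f z + gradf z \<bullet> (w - z) + L / 2 * (norm (w - z))\<^sup>2"
proof -
  let ?d = "w - z"
  \<comment> \<open>The claim is \<open>?\<phi> 1 \<le> ?\<phi> 0\<close>. The quadratic term is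
    chosen so that the Lipschitz bound makes the derivative nonpositive along the segment.\<close>
  let ?\<phi> = "\<lambda>t. f (z + t *\<^sub>R ?d) - t * (gradf z \<bullet> ?d) - L / 2 * t\<^sup>2 * (norm ?d)\<^sup>2"
  have D: "(?\<phi> has_real_derivative
      (gradf (z + t *\<^sub>R ?d) - gradf z) \<bullet> ?d - L * t * (norm ?d)\<^sup>2) (at t)" for t
  proof -
    have "((\<lambda>t. z + t *\<^sub>R ?d) has_derivative (\<lambda>h. h *\<^sub>R ?d)) (at t)"
      by (auto intro!: derivative_eq_intros)
    then have "((\<lambda>t. f (z + t *\<^sub>R ?d)) has_derivative (\<lambda>h. (h *\<^sub>R ?d) \<bullet> gradf (z + t *\<^sub>R ?d))) (at t)"
      using grad[of "z + t *\<^sub>R ?d"] unfolding gderiv_def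
      by (rule has_derivative_compose)
    then have "((\<lambda>t. f (z + t *\<^sub>R ?d)) has_real_derivative gradf (z + t *\<^sub>R ?d) \<bullet> ?d) (at t)"
      by (simp add: has_field_derivative_def inner_commute mult_commute_abs)
    then show ?thesis
      by (auto intro!: derivative_eq_intros simp: inner_diff_left power2_eq_square)
  qed
  have "?\<phi> 1 \<le> ?\<phi> 0"
  proof (rule DERIV_nonpos_imp_nonincreasing[of 0 1 ?\<phi>])
    fix t :: real assume t: "0 \<le> t" "t \<le> 1"
    have "(gradf (z + t *\<^sub>R ?d) - gradf z) \<bullet> ?d \<le> norm (gradf (z + t *\<^sub>R ?d) - gradf z) * norm ?d"
      by (rule norm_cauchy_schwarz)
    also have "\<dots> \<le> (L * norm (t *\<^sub>R ?d)) * norm ?d"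
      using lipschitz_onD[OF lip, of "z + t *\<^sub>R ?d" z] by (intro mult_right_mono) (auto simp: dist_norm)
    finally have "(gradf (z + t *\<^sub>R ?d) - gradf z) \<bullet> ?d - L * t * (norm ?d)\<^sup>2 \<le> 0"
      using t by (simp add: power2_eq_square mult_ac)
    with D show "\<exists>y. (?\<phi> has_real_derivative y) (at t) \<and> y \<le> 0" by blast
  qed simp
  then show ?thesis by simp
qed

text \<open>The gradient of \<open>- f\<close> has the same Lipschitz constant. This side gives
  \<open>f\<close> a quadratic minorant that can be added to those of the \<open>gs\<close>.\<close>

lemma descent_lemma_lower:
  fixes f :: "'a::real_inner \<Rightarrow> real"
  assumes grad: "\<And>z. GDERIV f z :> gradf z" and lip: "L-lipschitz_on UNIV gradf"
  shows "f z + gradf z \<bullet> (w - z) - L / 2 * (norm (w - z))\<^sup>2 \<le> f w"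
proof -
  have "- f w \<le> - f z + (- gradf z) \<bullet> (w - z) + L / 2 * (norm (w - z))\<^sup>2"
    by (rule descent_lemma[where f = "\<lambda>x. - f x" and gradf = "\<lambda>x. - gradf x"])
      (use grad lip in \<open>auto intro: GDERIV_minus\<close>)
  then show ?thesis by simp
qed

section \<open>Delayed descent and nearby iterates\<close>

text \<open>Summed over time, \<open>V\<close> telescopes and each of the \<open>s\<close> delays
  charges every \<open>e t\<close> at most once. Together with the undelayed term they cost
  \<open>2 * b * real s\<close> times the sum of \<open>e\<close>, up to the terms before
  \<open>t0\<close>, and \<open>a\<close> absorbs this.\<close>

lemma delayed_descent_summable:
  fixes V e :: "nat \<Rightarrow> real"
  assumes descent: "\<And>t. t \<ge> t0 \<Longrightarrow>
      V (Suc t) + a * e t \<le> V t + b * (real s * e t + (\<Sum>j<s. e (t - Suc j)))"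
    and bounded: "\<And>t. t \<ge> t0 \<Longrightarrow> m \<le> V t"
    and "s \<le> t0" and e: "\<And>t. e t \<ge> 0" and "b \<ge> 0" and "2 * b * real s < a"
  shows "summable e"
proof -
  define C where "C = (\<Sum>t<t0. e t)"
  define E where "E N = (\<Sum>n<N. e (t0 + n))" for N
  have delayed: "(\<Sum>n<N. e (t0 + n - Suc j)) \<le> C + E N" if "j < s" for j N
  proof -
    \<comment> \<open>\<open>Suc j \<le> s \<le> t0\<close> keeps the natural subtraction from
      truncating, so the shift is injective.\<close>
    have "(\<Sum>n<N. e (t0 + n - Suc j)) = (\<Sum>t\<in>(\<lambda>n. t0 + n - Suc j) ` {..<N}. e t)"
      using that \<open>s \<le> t0\<close> by (subst sum.reindex) (auto simp: inj_on_def)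
    also have "\<dots> \<le> (\<Sum>t<t0 + N. e t)"
      by (rule sum_mono2) (auto simp: e)
    also have "\<dots> = C + E N"
      unfolding C_def E_def by (induction N) auto
    finally show ?thesis .
  qed
  have sum_descent: "V (t0 + N) + a * E N
      \<le> V t0 + b * (real s * E N + (\<Sum>j<s. \<Sum>n<N. e (t0 + n - Suc j)))" for N
  proof (induction N)
    case (Suc N)
    show ?case
      using Suc descent[of "t0 + N"] by (simp add: E_def sum.distrib algebra_simps)
  qed (simp add: E_def)
  have "E N \<le> (V t0 - m + b * real s * C) / (a - 2 * b * real s)" for N
  proof -
    have "(\<Sum>j<s. \<Sum>n<N. e (t0 + n - Suc j)) \<le> (\<Sum>j<s. C + E N)"
      by (intro sum_mono delayed) auto
    then have "b * (real s * E N + (\<Sum>j<s. \<Sum>n<N. e (t0 + n - Suc j)))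
        \<le> b * (real s * E N + real s * (C + E N))"
      using \<open>b \<ge> 0\<close> by (intro mult_left_mono) auto
    then have "m + a * E N \<le> V t0 + b * (real s * E N + real s * (C + E N))"
      using sum_descent[of N] bounded[of "t0 + N"] by linarith
    then have "E N * (a - 2 * b * real s) \<le> V t0 - m + b * real s * C"
      by (simp add: algebra_simps)
    then show ?thesis
      using \<open>2 * b * real s < a\<close> by (subst pos_le_divide_eq) auto
  qed
  then have "summable (\<lambda>n. e (t0 + n))"
    unfolding E_def by (intro summableI_nonneg_bounded[OF e])
  then show ?thesis
    by (subst (asm) add.commute) (simp only: summable_iff_shift)
qed

lemma norm_diff_local_seq_le:
  fixes x :: "nat \<Rightarrow> real ^ 'n::finite"
  assumes "\<And>j. \<tau> i j t \<le> t" and "\<And>j. t - \<tau> i j t \<le> s"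
  shows "norm (x t - local_seq blk \<tau> x i t)
    \<le> (\<Sum>j<s. norm (x (Suc (t - Suc j)) - x (t - Suc j)))"
proof -
  \<comment> \<open>Coordinates have different delays. \<open>v j\<close> keeps the increment from
    time \<open>t - Suc j\<close> only in those stale enough to miss it, so one sum over
    \<open>j < s\<close> serves all coordinates; zeroing entries does not increase the norm. Where
    \<open>t - Suc j\<close> truncates, \<open>v j\<close> is \<open>0\<close>.\<close>
  define v where "v j = (\<chi> k. if j < t - \<tau> i (blk k) t
      then (x (Suc (t - Suc j)) - x (t - Suc j)) $ k else 0)" for j
  have tele: "(\<Sum>j<n. x (Suc (t - Suc j)) - x (t - Suc j)) = x t - x (t - n)" if "n \<le> t" for n
    using that by (induction n) (auto simp: Suc_diff_Suc)
  have "x t - local_seq blk \<tau> x i t = (\<Sum>j<s. v j)"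
  proof (subst vec_eq_iff, rule allI)
    fix k
    have "(\<Sum>j<s. v j) $ k
        = (\<Sum>j<t - \<tau> i (blk k) t. (x (Suc (t - Suc j)) - x (t - Suc j)) $ k)"
      using assms(2)[of "blk k"] unfolding v_def sum_component
      by (intro sum.mono_neutral_cong_right) auto
    also have "\<dots> = (x t - x (t - (t - \<tau> i (blk k) t))) $ k"
      by (subst tele[symmetric]) (simp_all only: diff_le_self sum_component)
    also have "t - (t - \<tau> i (blk k) t) = \<tau> i (blk k) t"
      using assms(1)[of "blk k"] by simp
    finally show "(x t - local_seq blk \<tau> x i t) $ k = (\<Sum>j<s. v j) $ k"
      by (simp add: local_seq_def)
  qed
  also have "norm \<dots> \<le> (\<Sum>j<s. norm (v j))"
    by (rule norm_sum)
  also have "\<dots> \<le> (\<Sum>j<s. norm (x (Suc (t - Suc j)) - x (t - Suc j)))"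
    by (intro sum_mono norm_le_componentwise_cart) (auto simp: v_def)
  finally show ?thesis .
qed

lemma local_seq_tendsto:
  fixes x :: "nat \<Rightarrow> real ^ 'n::finite"
  assumes "\<And>j t. \<tau> i j t \<le> t" and "\<And>j t. t - \<tau> i j t \<le> s"
    and increments: "(\<lambda>t. x (Suc t) - x t) \<longlonglongrightarrow> 0"
  shows "(\<lambda>t. x t - local_seq blk \<tau> x i t) \<longlonglongrightarrow> 0"
proof (rule Lim_null_comparison)
  show "\<forall>\<^sub>F t in sequentially. norm (x t - local_seq blk \<tau> x i t)
      \<le> (\<Sum>j<s. norm (x (Suc (t - Suc j)) - x (t - Suc j)))"
    by (intro always_eventually allI norm_diff_local_seq_le assms)
  have "(\<lambda>t. norm (x (Suc (t - Suc j)) - x (t - Suc j))) \<longlonglongrightarrow> 0" for j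
    by (rule filterlim_compose[OF tendsto_norm_zero[OF increments] filterlim_minus_const_nat_at_top])
  then show "(\<lambda>t. \<Sum>j<s. norm (x (Suc (t - Suc j)) - x (t - Suc j))) \<longlonglongrightarrow> 0"
    by (intro tendsto_null_sum)
qed

text \<open>Blocks are updated at different times of a window. Telescoping over at most
  \<open>c\<close> vanishing increments shows that all these times see the same limit.\<close>

lemma nearby_times_tendsto:
  fixes x :: "nat \<Rightarrow> 'a::real_normed_vector"
  assumes increments: "(\<lambda>t. x (Suc t) - x t) \<longlonglongrightarrow> 0"
    and r: "filterlim r at_top sequentially" and x: "(\<lambda>k. x (r k)) \<longlonglongrightarrow> y"
    and near: "\<And>k. r k \<le> \<sigma> k" "\<And>k. \<sigma> k \<le> r k + c"
  shows "(\<lambda>k. x (\<sigma> k)) \<longlonglongrightarrow> y"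
proof -
  have "(\<lambda>k. x (\<sigma> k) - x (r k)) \<longlonglongrightarrow> 0"
  proof (rule Lim_null_comparison)
    have tele: "(\<Sum>j<n. x (Suc (t + j)) - x (t + j)) = x (t + n) - x t" for n t
      by (induction n) auto
    have "norm (x (\<sigma> k) - x (r k)) \<le> (\<Sum>j<c. norm (x (Suc (r k + j)) - x (r k + j)))" for k
    proof -
      have "norm (x (\<sigma> k) - x (r k)) = norm (\<Sum>j<\<sigma> k - r k. x (Suc (r k + j)) - x (r k + j))"
        using near[of k] by (simp add: tele)
      also have "\<dots> \<le> (\<Sum>j<\<sigma> k - r k. norm (x (Suc (r k + j)) - x (r k + j)))"
        by (rule norm_sum)
      \<comment> \<open>Padding to \<open>c\<close> terms makes the number of summands independent
        of \<open>k\<close>.\<close>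
      also have "\<dots> \<le> (\<Sum>j<c. norm (x (Suc (r k + j)) - x (r k + j)))"
        using near(2)[of k] by (intro sum_mono2) auto
      finally show ?thesis .
    qed
    then show "\<forall>\<^sub>F k in sequentially. norm (x (\<sigma> k) - x (r k))
        \<le> (\<Sum>j<c. norm (x (Suc (r k + j)) - x (r k + j)))" by simp
    have "(\<lambda>k. norm (x (Suc (r k + j)) - x (r k + j))) \<longlonglongrightarrow> 0" for j
      by (rule filterlim_compose[OF tendsto_norm_zero[OF increments]])
        (rule filterlim_at_top_mono[OF r], simp)
    then show "(\<lambda>k. \<Sum>j<c. norm (x (Suc (r k + j)) - x (r k + j))) \<longlonglongrightarrow> 0"
      by (intro tendsto_null_sum)
  qed
  from tendsto_add[OF this x] show ?thesis by simp
qed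

lemma limit_points_eqI:
  fixes X Y :: "nat \<Rightarrow> 'a::real_normed_vector"
  assumes "(\<lambda>t. X t - Y t) \<longlonglongrightarrow> 0"
  shows "limit_points Y = limit_points X"
proof -
  have *: "(X \<circ> r) \<longlonglongrightarrow> y \<longleftrightarrow> (Y \<circ> r) \<longlonglongrightarrow> y" if "strict_mono r" for r y
    using Lim_transform_eq[of "X \<circ> r" "Y \<circ> r"] LIMSEQ_subseq_LIMSEQ[OF assms that]
    by (simp add: o_def)
  then show ?thesis by (auto simp: limit_points_def)
qed

section \<open>Blockwise proximal steps of a run\<close>

locale mpapg_run =
  fixes blk :: "'n::finite \<Rightarrow> 'p::finite"
    and f :: "real ^ 'n \<Rightarrow> real"
    and gradf :: "real ^ 'n \<Rightarrow> real ^ 'n"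
    and gs :: "'p \<Rightarrow> real ^ 'n \<Rightarrow> ereal"
    and F :: "real ^ 'n \<Rightarrow> ereal"
    and L \<eta> :: real
    and s :: nat
    and T :: "'p \<Rightarrow> nat set"
    and \<tau> :: "'p \<Rightarrow> 'p \<Rightarrow> nat \<Rightarrow> nat"
    and x :: "nat \<Rightarrow> real ^ 'n"
  assumes grad_f: "\<And>z. GDERIV f z :> gradf z"
    and gs_proper: "\<And>i. proper_on (block_space blk i) (gs i)"
    and gs_closed: "\<And>i. closed_fun_on (block_space blk i) (gs i)"
    and F_eq: "\<And>z. F z = ereal (f z) + (\<Sum>i\<in>UNIV. gs i (block blk i z))"
    and F_bounded_below: "\<exists>m::real. \<forall>z. ereal m \<le> F z"
    and L_pos: "L > 0"
    and grad_lipschitz: "L-lipschitz_on UNIV gradf"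
    and delay_valid: "\<And>i j t. \<tau> i j t \<le> t"
    and bounded_delay: "\<And>i j t. t - \<tau> i j t \<le> s"
    and frequent_update: "\<And>i t. T i \<inter> {t..t + s} \<noteq> {}"
    and eta_pos: "\<eta> > 0"
    and step_bound: "\<eta> < 1 / (L * (1 + 2 * sqrt (real CARD('p)) * real s))"
    and generated: "mpapg blk gradf gs \<eta> T \<tau> x"
begin

definition xi :: "'p \<Rightarrow> nat \<Rightarrow> real ^ 'n" where
  "xi i t = block blk i (x t)"

definition loc :: "'p \<Rightarrow> nat \<Rightarrow> real ^ 'n" where
  "loc i t = local_seq blk \<tau> x i t"

text \<open>The initial block may have an infinite value, for which \<open>real_of_ereal\<close>
  returns \<open>0\<close>; by \<open>finite_after\<close>, \<open>G\<close> is the true value once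
  \<open>t > s\<close>.\<close>

definition G :: "'p \<Rightarrow> nat \<Rightarrow> real" where
  "G i t = real_of_ereal (gs i (xi i t))"

text \<open>\<open>- slope i t\<close> is the subgradient of \<open>gs i\<close> at \<open>xi i (Suc t)\<close> given by the optimality condition
  of the proximal step.\<close>

definition slope :: "'p \<Rightarrow> nat \<Rightarrow> real ^ 'n" where
  "slope i t = (1 / \<eta>) *\<^sub>R (xi i (Suc t) - xi i t) + block blk i (gradf (loc i t))"

lemma xi_in [simp]: "xi i t \<in> block_space blk i"
  by (simp add: xi_def)

lemma inactive: "t \<notin> T i \<Longrightarrow> xi i (Suc t) = xi i t"
  using generated by (auto simp: mpapg_def xi_def)

text \<open>\<open>prox_onD\<close> for the gradient step \<open>?c\<close>: the residual divided by
  \<open>\<eta>\<close> is exactly \<open>slope i t\<close>.\<close>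

lemma active:
  assumes "t \<in> T i"
  shows active_finite: "gs i (xi i (Suc t)) = ereal (G i (Suc t))"
    and active_minorant: "w \<in> block_space blk i \<Longrightarrow>
      ereal (G i (Suc t) - slope i t \<bullet> (w - xi i (Suc t))
        - 1 / (2 * \<eta>) * (norm (w - xi i (Suc t)))\<^sup>2) \<le> gs i w"
proof -
  let ?c = "xi i t - \<eta> *\<^sub>R block blk i (gradf (loc i t))"
  have "xi i (Suc t) \<in> prox_on (block_space blk i) (gs i) \<eta> ?c"
    using generated assms by (auto simp: mpapg_def xi_def loc_def)
  then obtain r where r: "gs i (xi i (Suc t)) = ereal r"
    and le: "\<And>w. w \<in> block_space blk i \<Longrightarrow>
      ereal (r - ((1 / \<eta>) *\<^sub>R (xi i (Suc t) - ?c)) \<bullet> (w - xi i (Suc t))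
        - 1 / (2 * \<eta>) * (norm (w - xi i (Suc t)))\<^sup>2) \<le> gs i w"
    by (rule prox_onD[OF _ gs_proper eta_pos]) blast
  have G: "G i (Suc t) = r" by (simp add: G_def r)
  show "gs i (xi i (Suc t)) = ereal (G i (Suc t))" by (simp add: r G)
  have slope: "(1 / \<eta>) *\<^sub>R (xi i (Suc t) - ?c) = slope i t"
    using eta_pos by (simp add: slope_def algebra_simps)
  show "w \<in> block_space blk i \<Longrightarrow>
      ereal (G i (Suc t) - slope i t \<bullet> (w - xi i (Suc t))
        - 1 / (2 * \<eta>) * (norm (w - xi i (Suc t)))\<^sup>2) \<le> gs i w"
    using le[of w] unfolding slope G .
qed

text \<open>Every block is updated by time \<open>s\<close>, which takes effect one step later. From
  then on, updates and idle steps keep the value finite.\<close>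

lemma finite_after:
  assumes "t > s"
  shows "gs i (xi i t) = ereal (G i t)"
proof -
  obtain u where u: "u \<in> T i" "u \<le> s" using frequent_update[of i 0] by auto
  then have "Suc u \<le> t" using assms by simp
  then show ?thesis
  proof (induction t rule: dec_induct)
    case base
    show ?case using u(1) by (rule active_finite)
  next
    case (step n)
    show ?case
    proof (cases "n \<in> T i")
      case True
      then show ?thesis by (rule active_finite)
    next
      case False
      then have "xi i (Suc n) = xi i n" by (rule inactive)
      then have "G i (Suc n) = G i n" by (simp add: G_def)
      with \<open>xi i (Suc n) = xi i n\<close> step.IH show ?thesis by simp
    qed
  qed
qed

text \<open>The minorant is tested at the old block, whose value is finite since
  \<open>t > s\<close>. The slope contributes \<open>1 / \<eta>\<close> times the squared step, of
  which the quadratic error takes half. For an idle block the step is \<open>0\<close>.\<close>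

lemma block_descent:
  assumes "t > s"
  shows "G i (Suc t) + 1 / (2 * \<eta>) * (norm (block blk i (x (Suc t) - x t)))\<^sup>2
    + block blk i (x (Suc t) - x t) \<bullet> gradf (loc i t) \<le> G i t"
proof (cases "t \<in> T i")
  case True
  let ?d = "xi i (Suc t) - xi i t"
  have "G i (Suc t) + slope i t \<bullet> ?d - 1 / (2 * \<eta>) * (norm ?d)\<^sup>2 \<le> G i t"
    using active_minorant[OF True, of "xi i t"] finite_after[OF assms, of i]
    by (simp add: norm_minus_commute inner_diff_right)
  moreover have "slope i t \<bullet> ?d = 1 / \<eta> * (norm ?d)\<^sup>2 + ?d \<bullet> gradf (loc i t)"
    using inner_block_block[of blk i "gradf (loc i t)" "x (Suc t) - x t"]
    unfolding slope_def xi_def block_diff[symmetric] inner_add_left power2_norm_eq_inner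
    by (simp add: inner_block_block inner_commute[of "gradf (loc i t)"])
  ultimately show ?thesis by (simp add: xi_def block_diff)
next
  case False
  then show ?thesis using inactive[OF False] by (simp add: xi_def block_diff G_def)
qed

section \<open>Square-summable increments\<close>

lemma increment_summable: "summable (\<lambda>t. (norm (x (Suc t) - x t))\<^sup>2)"
proof -
  define V where "V t = f (x t) + (\<Sum>i\<in>UNIV. G i t)" for t
  define D where "D t = norm (x (Suc t) - x t)" for t
  define P where "P = sqrt (real CARD('p))"
  have "P > 0" by (simp add: P_def)
  obtain m where m: "\<And>z. ereal m \<le> F z" using F_bounded_below by blast
  \<comment> \<open>From \<open>Suc s\<close> on, \<open>V\<close> is the real value of
    \<open>F\<close>. \<open>a\<close> is the proximal decrease less the error of the descent lemma;
    \<open>b\<close> is the coefficient of the stale terms after AM-GM.\<close>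
  show ?thesis
  proof (rule delayed_descent_summable[where V = V and ?t0.0 = "Suc s" and m = m and s = s
      and a = "1 / (2 * \<eta>) - L / 2" and b = "L * P / 2"])
    fix t assume "t \<ge> Suc s"
    then have t: "t > s" by simp
    have "F (x t) = ereal (V t)"
      using finite_after[OF t] by (simp add: F_eq V_def flip: xi_def)
    then show "m \<le> V t" using m[of "x t"] by simp
    let ?\<Delta> = "x (Suc t) - x t"
    let ?S = "\<Sum>j<s. D (t - Suc j)"
    have S: "?S \<ge> 0" by (simp add: D_def sum_nonneg)
    have "(\<Sum>i\<in>UNIV. G i (Suc t) + 1 / (2 * \<eta>) * (norm (block blk i ?\<Delta>))\<^sup>2
        + block blk i ?\<Delta> \<bullet> gradf (loc i t)) \<le> (\<Sum>i\<in>UNIV. G i t)"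
      by (intro sum_mono block_descent t)
    then have G: "(\<Sum>i\<in>UNIV. G i (Suc t)) + 1 / (2 * \<eta>) * (D t)\<^sup>2
        + (\<Sum>i\<in>UNIV. block blk i ?\<Delta> \<bullet> gradf (loc i t)) \<le> (\<Sum>i\<in>UNIV. G i t)"
      by (simp add: sum.distrib sum_norm_block_sq D_def flip: sum_distrib_left sum_divide_distrib)
    have f: "f (x (Suc t)) \<le> f (x t) + gradf (x t) \<bullet> ?\<Delta> + L / 2 * (D t)\<^sup>2"
      unfolding D_def by (rule descent_lemma[OF grad_f grad_lipschitz])
    \<comment> \<open>Adding the bound for \<open>f\<close> to the blockwise bounds leaves only the
      gap between current and stale gradients.\<close>
    have "gradf (x t) \<bullet> ?\<Delta> - (\<Sum>i\<in>UNIV. block blk i ?\<Delta> \<bullet> gradf (loc i t))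
        = (\<Sum>i\<in>UNIV. block blk i ?\<Delta> \<bullet> (gradf (x t) - gradf (loc i t)))"
      by (simp add: inner_diff_right sum_subtractf inner_commute[of "gradf (x t)"] sum_block
          flip: inner_sum_left) (simp add: inner_diff_left)
    also have "\<dots> \<le> (\<Sum>i\<in>UNIV. norm (block blk i ?\<Delta>) * (L * ?S))"
    proof (rule sum_mono)
      fix i
      have "norm (gradf (x t) - gradf (loc i t)) \<le> L * norm (x t - loc i t)"
        using lipschitz_onD[OF grad_lipschitz, of "x t" "loc i t"] by (simp add: dist_norm)
      also have "\<dots> \<le> L * ?S"
        unfolding loc_def D_def using L_pos
        by (intro mult_left_mono norm_diff_local_seq_le delay_valid bounded_delay) simp
      finally have "norm (block blk i ?\<Delta>) * norm (gradf (x t) - gradf (loc i t))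
          \<le> norm (block blk i ?\<Delta>) * (L * ?S)" by (intro mult_left_mono) auto
      then show "block blk i ?\<Delta> \<bullet> (gradf (x t) - gradf (loc i t)) \<le> norm (block blk i ?\<Delta>) * (L * ?S)"
        using norm_cauchy_schwarz order_trans by blast
    qed
    also have "\<dots> \<le> P * D t * (L * ?S)"
      unfolding sum_distrib_right[symmetric] P_def D_def using L_pos S
      by (intro mult_right_mono sum_norm_block_le) (simp add: D_def)
    \<comment> \<open>Arranged for AM-GM in the form
      \<open>2 * u * v \<le> u\<^sup>2 + v\<^sup>2\<close>.\<close>
    also have "\<dots> = L * P / 2 * (\<Sum>j<s. 2 * D t * D (t - Suc j))"
      by (simp add: sum_distrib_left mult_ac)
    also have "\<dots> \<le> L * P / 2 * (\<Sum>j<s. (D t)\<^sup>2 + (D (t - Suc j))\<^sup>2)"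
      using L_pos \<open>P > 0\<close> by (intro mult_left_mono sum_mono sum_squares_bound) auto
    finally have "gradf (x t) \<bullet> ?\<Delta> - (\<Sum>i\<in>UNIV. block blk i ?\<Delta> \<bullet> gradf (loc i t))
        \<le> L * P / 2 * (real s * (D t)\<^sup>2 + (\<Sum>j<s. (D (t - Suc j))\<^sup>2))"
      by (simp add: sum.distrib)
    with f G show "V (Suc t) + (1 / (2 * \<eta>) - L / 2) * (norm ?\<Delta>)\<^sup>2
        \<le> V t + L * P / 2 * (real s * (norm ?\<Delta>)\<^sup>2
          + (\<Sum>j<s. (norm (x (Suc (t - Suc j)) - x (t - Suc j)))\<^sup>2))"
      unfolding V_def D_def left_diff_distrib by linarith
  next
    \<comment> \<open>The step size condition amounts to
      \<open>L * (1 + 2 * P * real s) < 1 / \<eta>\<close>; halved, it says that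
      \<open>2 * b * real s < a\<close>.\<close>
    have "1 + 2 * P * real s > 0" using \<open>P > 0\<close> by (simp add: add_pos_nonneg)
    then have "\<eta> * (L * (1 + 2 * P * real s)) < 1"
      using step_bound L_pos by (simp add: P_def pos_less_divide_eq)
    then have "L * (1 + 2 * P * real s) < 1 / \<eta>"
      using eta_pos by (simp add: pos_less_divide_eq mult.commute)
    then show "2 * (L * P / 2) * real s < 1 / (2 * \<eta>) - L / 2"
      by (simp add: field_simps)
  qed (use L_pos \<open>P > 0\<close> in auto)
qed

lemma increments_tendsto: "(\<lambda>t. x (Suc t) - x t) \<longlonglongrightarrow> 0"
proof (rule tendsto_norm_zero_cancel)
  have "(\<lambda>t. sqrt ((norm (x (Suc t) - x t))\<^sup>2)) \<longlonglongrightarrow> sqrt 0"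
    by (intro tendsto_real_sqrt summable_LIMSEQ_zero increment_summable)
  then show "(\<lambda>t. norm (x (Suc t) - x t)) \<longlonglongrightarrow> 0" by simp
qed

lemma diff_loc_tendsto: "(\<lambda>t. x t - loc i t) \<longlonglongrightarrow> 0"
  unfolding loc_def
  by (rule local_seq_tendsto[where s = s]) (use delay_valid bounded_delay increments_tendsto in auto)

lemma isCont_gradf: "isCont gradf z"
  using lipschitz_on_continuous_on[OF grad_lipschitz] by (simp add: continuous_on_eq_continuous_at)

lemma isCont_f: "isCont f z"
  using grad_f[of z] unfolding gderiv_def by (rule has_derivative_continuous)

section \<open>Criticality of limit points\<close>

text \<open>The increment part vanishes, and the stale points share the limit of
  \<open>x (\<sigma> k)\<close>, so continuity of \<open>gradf\<close> gives the rest.\<close>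

lemma slope_tendsto:
  assumes \<sigma>: "filterlim \<sigma> at_top sequentially" and x: "(\<lambda>k. x (\<sigma> k)) \<longlonglongrightarrow> y"
  shows "(\<lambda>k. slope i (\<sigma> k)) \<longlonglongrightarrow> block blk i (gradf y)"
proof -
  have "(\<lambda>k. x (\<sigma> k) - (x (\<sigma> k) - loc i (\<sigma> k))) \<longlonglongrightarrow> y - 0"
    by (intro tendsto_diff x filterlim_compose[OF diff_loc_tendsto \<sigma>])
  then have "(\<lambda>k. loc i (\<sigma> k)) \<longlonglongrightarrow> y" by simp
  then have "(\<lambda>k. block blk i (gradf (loc i (\<sigma> k)))) \<longlonglongrightarrow> block blk i (gradf y)"
    by (intro tendsto_block isCont_tendsto_compose[OF isCont_gradf])
  moreover have "(\<lambda>k. (1 / \<eta>) *\<^sub>R block blk i (x (Suc (\<sigma> k)) - x (\<sigma> k)))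
      \<longlonglongrightarrow> (1 / \<eta>) *\<^sub>R block blk i 0"
    by (intro tendsto_scaleR tendsto_const tendsto_block filterlim_compose[OF increments_tendsto \<sigma>])
  ultimately have "(\<lambda>k. (1 / \<eta>) *\<^sub>R block blk i (x (Suc (\<sigma> k)) - x (\<sigma> k))
      + block blk i (gradf (loc i (\<sigma> k)))) \<longlonglongrightarrow> (1 / \<eta>) *\<^sub>R block blk i 0 + block blk i (gradf y)"
    by (rule tendsto_add[rotated])
  then show ?thesis
    by (simp add: slope_def xi_def linear_0[OF linear_block] flip: block_diff)
qed

text \<open>Update times may differ between blocks, so \<open>z\<close> need not be an iterate. The
  block minorants and the lower bound for \<open>f\<close> still add up to one quadratic minorant of
  \<open>F\<close> at \<open>z\<close>.\<close>

lemma F_subgradient: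
  assumes active: "\<And>i. \<sigma> i \<in> T i" and z: "\<And>i. block blk i z = xi i (Suc (\<sigma> i))"
  shows "gradf z - (\<Sum>i\<in>UNIV. slope i (\<sigma> i)) \<in> frechet_subdiff F z"
proof (rule frechet_subdiff_quadraticI[where C = "L / 2 + 1 / (2 * \<eta>)"
      and r = "f z + (\<Sum>i\<in>UNIV. G i (Suc (\<sigma> i)))"])
  show "F z = ereal (f z + (\<Sum>i\<in>UNIV. G i (Suc (\<sigma> i))))"
    using active_finite[OF active] by (simp add: F_eq z)
next
  fix w
  let ?d = "w - z"
  have slope_block: "slope i t = block blk i (slope i t)" for i t
    by (simp add: slope_def xi_def block_add block_diff block_scaleR block_block)
  have slope: "slope i t \<bullet> block blk i v = slope i t \<bullet> v" for i t v
    by (subst (1 2) slope_block) (metis inner_block_block inner_commute)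
  have f: "f z + gradf z \<bullet> ?d - L / 2 * (norm ?d)\<^sup>2 \<le> f w"
    by (rule descent_lemma_lower[OF grad_f grad_lipschitz])
  have "(\<Sum>i\<in>UNIV. ereal (G i (Suc (\<sigma> i)) - slope i (\<sigma> i) \<bullet> block blk i ?d
      - 1 / (2 * \<eta>) * (norm (block blk i ?d))\<^sup>2)) \<le> (\<Sum>i\<in>UNIV. gs i (block blk i w))"
    using active_minorant[OF active, of "block blk _ w"]
    by (intro sum_mono) (simp add: block_diff flip: z)
  also have "(\<Sum>i\<in>UNIV. ereal (G i (Suc (\<sigma> i)) - slope i (\<sigma> i) \<bullet> block blk i ?d
      - 1 / (2 * \<eta>) * (norm (block blk i ?d))\<^sup>2))
    = ereal ((\<Sum>i\<in>UNIV. G i (Suc (\<sigma> i))) - (\<Sum>i\<in>UNIV. slope i (\<sigma> i)) \<bullet> ?d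
      - 1 / (2 * \<eta>) * (norm ?d)\<^sup>2)"
    by (simp add: slope sum_subtractf inner_sum_left sum_norm_block_sq flip: sum_distrib_left sum_divide_distrib)
  finally have g: "ereal ((\<Sum>i\<in>UNIV. G i (Suc (\<sigma> i))) - (\<Sum>i\<in>UNIV. slope i (\<sigma> i)) \<bullet> ?d
      - 1 / (2 * \<eta>) * (norm ?d)\<^sup>2) \<le> (\<Sum>i\<in>UNIV. gs i (block blk i w))" .
  have "ereal (f z + (\<Sum>i\<in>UNIV. G i (Suc (\<sigma> i))) + (gradf z - (\<Sum>i\<in>UNIV. slope i (\<sigma> i))) \<bullet> ?d
      - (L / 2 + 1 / (2 * \<eta>)) * (norm ?d)\<^sup>2)
    = ereal (f z + gradf z \<bullet> ?d - L / 2 * (norm ?d)\<^sup>2)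
      + ereal ((\<Sum>i\<in>UNIV. G i (Suc (\<sigma> i))) - (\<Sum>i\<in>UNIV. slope i (\<sigma> i)) \<bullet> ?d
      - 1 / (2 * \<eta>) * (norm ?d)\<^sup>2)"
    by (simp add: inner_diff_left distrib_right)
  also have "\<dots> \<le> F w"
    unfolding F_eq by (intro add_mono g) (use f in simp)
  finally show "ereal (f z + (\<Sum>i\<in>UNIV. G i (Suc (\<sigma> i)))
      + (gradf z - (\<Sum>i\<in>UNIV. slope i (\<sigma> i))) \<bullet> ?d
      - (L / 2 + 1 / (2 * \<eta>)) * (norm ?d)\<^sup>2) \<le> F w" .
qed

lemma limit_points_subset_crit: "limit_points x \<subseteq> crit F"
proof
  fix y assume "y \<in> limit_points x"
  then obtain r where r: "strict_mono r" and xr: "(\<lambda>k. x (r k)) \<longlonglongrightarrow> y"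
    by (auto simp: limit_points_def o_def)
  have r_top: "filterlim r at_top sequentially" using r by (rule filterlim_subseq)
  have "\<forall>i k. \<exists>u. u \<in> T i \<inter> {r k..r k + s}" using frequent_update by blast
  then obtain \<sigma> where \<sigma>: "\<And>i k. \<sigma> i k \<in> T i" "\<And>i k. r k \<le> \<sigma> i k" "\<And>i k. \<sigma> i k \<le> r k + s"
    by (metis Int_iff atLeastAtMost_iff)
  have \<sigma>_top: "filterlim (\<sigma> i) at_top sequentially" for i
    by (rule filterlim_at_top_mono[OF r_top]) (simp add: \<sigma>)
  have x\<sigma>: "(\<lambda>k. x (\<sigma> i k)) \<longlonglongrightarrow> y" for i
    by (rule nearby_times_tendsto[OF increments_tendsto r_top xr]) (rule \<sigma>)+
  \<comment> \<open>An update shows one step later, so the window grows to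
    \<open>Suc s\<close>.\<close>
  have xS: "(\<lambda>k. x (Suc (\<sigma> i k))) \<longlonglongrightarrow> y" for i
    by (rule nearby_times_tendsto[OF increments_tendsto r_top xr, where c = "Suc s"])
      (simp_all add: \<sigma> le_SucI)
  have xi_lim: "(\<lambda>k. xi i (Suc (\<sigma> i k))) \<longlonglongrightarrow> block blk i y" for i
    unfolding xi_def by (intro tendsto_block xS)
  \<comment> \<open>Every block of \<open>z k\<close> is fresh from a proximal step, as
    \<open>F_subgradient\<close> demands.\<close>
  define z where "z k = (\<Sum>i\<in>UNIV. xi i (Suc (\<sigma> i k)))" for k
  have block_z: "block blk i (z k) = xi i (Suc (\<sigma> i k))" for i k
    unfolding z_def xi_def by (rule block_sum_block)
  have "z \<longlonglongrightarrow> (\<Sum>i\<in>UNIV. block blk i y)"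
    unfolding z_def by (intro tendsto_sum xi_lim)
  then have z_lim: "z \<longlonglongrightarrow> y" by (simp add: sum_block)
  have slope_lim: "(\<lambda>k. slope i (\<sigma> i k)) \<longlonglongrightarrow> block blk i (gradf y)" for i
    by (rule slope_tendsto[OF \<sigma>_top x\<sigma>])
  \<comment> \<open>The \<open>gs\<close> need not be continuous. Convergent slopes and the common
    curvature \<open>1 / (2 * \<eta>)\<close> give convergence of the values, and also finiteness of
    \<open>F y\<close>.\<close>
  have "\<exists>\<gamma>. gs i (block blk i y) = ereal \<gamma> \<and> (\<lambda>k. G i (Suc (\<sigma> i k))) \<longlonglongrightarrow> \<gamma>" for i
    by (rule quadratic_minorants_imp_attentive[OF gs_closed[of i] gs_proper[of i] xi_lim xi_in
        block_in_block_space active_finite[OF \<sigma>(1)] active_minorant[OF \<sigma>(1)] slope_lim]) auto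
  then obtain \<gamma> where \<gamma>: "\<And>i. gs i (block blk i y) = ereal (\<gamma> i)"
    "\<And>i. (\<lambda>k. G i (Suc (\<sigma> i k))) \<longlonglongrightarrow> \<gamma> i" by metis
  have Fy: "F y = ereal (f y + (\<Sum>i\<in>UNIV. \<gamma> i))"
    by (simp add: F_eq \<gamma>)
  have "(\<lambda>k. f (z k) + (\<Sum>i\<in>UNIV. G i (Suc (\<sigma> i k)))) \<longlonglongrightarrow> f y + (\<Sum>i\<in>UNIV. \<gamma> i)"
    by (intro tendsto_intros \<gamma> isCont_tendsto_compose[OF isCont_f] z_lim)
  then have F_lim: "(\<lambda>k. F (z k)) \<longlonglongrightarrow> F y"
    using active_finite[OF \<sigma>(1)] unfolding Fy by (simp add: F_eq block_z)
  \<comment> \<open>In the limit the slopes sum to the full gradient at \<open>y\<close>, so the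
    subgradients tend to \<open>0\<close>.\<close>
  have "(\<lambda>k. gradf (z k) - (\<Sum>i\<in>UNIV. slope i (\<sigma> i k)))
      \<longlonglongrightarrow> gradf y - (\<Sum>i\<in>UNIV. block blk i (gradf y))"
    by (intro tendsto_intros slope_lim isCont_tendsto_compose[OF isCont_gradf] z_lim)
  then have u_lim: "(\<lambda>k. gradf (z k) - (\<Sum>i\<in>UNIV. slope i (\<sigma> i k))) \<longlonglongrightarrow> 0"
    by (simp add: sum_block)
  have "gradf (z k) - (\<Sum>i\<in>UNIV. slope i (\<sigma> i k)) \<in> frechet_subdiff F (z k)" for k
    by (rule F_subgradient[of "\<lambda>i. \<sigma> i k"]) (simp_all add: \<sigma> block_z)
  then show "y \<in> crit F"
    using z_lim F_lim u_lim Fy unfolding crit_def limiting_subdiff_def mem_Collect_eq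
    by (intro conjI exI[of _ z] exI[of _ "\<lambda>k. gradf (z k) - (\<Sum>i\<in>UNIV. slope i (\<sigma> i k))"]) auto
qed

end

theorem theorem4p2:
  fixes blk :: "'n::finite \<Rightarrow> 'p::finite"
    and f :: "real ^ 'n \<Rightarrow> real"
    and gradf :: "real ^ 'n \<Rightarrow> real ^ 'n"
    and g :: "real ^ 'n \<Rightarrow> ereal"
    and gs :: "'p \<Rightarrow> real ^ 'n \<Rightarrow> ereal"
    and F :: "real ^ 'n \<Rightarrow> ereal"
    and L \<eta> :: real
    and s :: nat
    and T :: "'p \<Rightarrow> nat set"
    and \<tau> :: "'p \<Rightarrow> 'p \<Rightarrow> nat \<Rightarrow> nat"
    and x :: "nat \<Rightarrow> real ^ 'n"
  assumes grad_f: "\<And>z. GDERIV f z :> gradf z"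
    and g_proper: "proper_on UNIV g"
    and g_closed: "closed_fun_on UNIV g"
    and gs_proper: "\<And>i. proper_on (block_space blk i) (gs i)"
    and gs_closed: "\<And>i. closed_fun_on (block_space blk i) (gs i)"
    and separable: "\<And>z. g z = (\<Sum>i\<in>UNIV. gs i (block blk i z))"
    and F_eq: "\<And>z. F z = ereal (f z) + g z"
    and F_bounded_below: "\<exists>m::real. \<forall>z. ereal m \<le> F z"
    and L_pos: "L > 0"
    and grad_lipschitz: "L-lipschitz_on UNIV gradf"
    and delay_valid: "\<And>i j t. \<tau> i j t \<le> t"
    and bounded_delay: "\<And>i j t. t - \<tau> i j t \<le> s"
    and own_block_current: "\<And>i t. \<tau> i i t = t"
    and frequent_update: "\<And>i t. T i \<inter> {t..t + s} \<noteq> {}"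
    and step_size: "\<eta> \<in> {0<..<1 / (L * (1 + 2 * sqrt (real CARD('p)) * real s))}"
    and generated: "mpapg blk gradf gs \<eta> T \<tau> x"
  shows "(\<forall>i. limit_points (local_seq blk \<tau> x i) = limit_points x) \<and>
         limit_points x \<subseteq> crit F"
proof -
  interpret mpapg_run blk f gradf gs F L \<eta> s T \<tau> x
  proof
    show "F z = ereal (f z) + (\<Sum>i\<in>UNIV. gs i (block blk i z))" for z
      by (simp add: F_eq separable)
    show "\<eta> > 0" "\<eta> < 1 / (L * (1 + 2 * sqrt (real CARD('p)) * real s))"
      using step_size by simp_all
  qed (rule assms)+
  show ?thesis
    using limit_points_eqI[OF diff_loc_tendsto] limit_points_subset_crit
    by (simp add: loc_def)
qed

end
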